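(* Suppose $G$ is an equal rank real reductive algebraic group with strong involution $x\in Z(K)$. Write $z=x^2\in Z(G)$. Suppose $J$ is an irreducible $(\mathfrak g,K(\mathbb C))$-module admitting a $c$-invariant Hermitian form $\langle,\rangle^c_J$, in which $z$ acts by the scalar $\zeta\in\mathbb C^\times$. Fix a square root $\zeta^{1/2}$ of $\zeta$. Then $J$ admits an invariant Hermitian form $\langle,\rangle^0_J$ defined by the formula $$\langle v,w\rangle^0_J=\zeta^{-1/2}\langle x\cdot v,w\rangle^c_J.$$ For each $\mu\in\widehat K_\zeta$, the forms on the $\mu$-multiplicity spaces are therefore related by $\langle,\rangle^0_{J^\mu}=\epsilon(\mu)\langle,\rangle^c_{J^\mu}$. Consequently the signature functions are related by $$(\mathrm{pos}^0_J(\mu),\mathrm{neg}^0_J(\mu))=\begin{cases}(\mathrm{pos}^c_J(\mu),\mathrm{neg}^c_J(\mu))&(\epsilon(\mu)=+1)\\(\mathrm{neg}^c_J(\mu),\mathrm{pos}^c_J(\mu))&(\epsilon(\mu)=-1).\end{cases}$$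
   Context: $G(\mathbb C)$ is a connected complex reductive algebraic group, $\sigma_0$ a real form (antiholomorphic involutive automorphism), $G=G(\mathbb C)^{\sigma_0}$; $\sigma_c$ is a compact real form commuting with $\sigma_0$, $\theta=\sigma_0\sigma_c$ the Cartan involution, $K=G^\theta$, with complexification $K(\mathbb C)=G(\mathbb C)^\theta$. $\mathfrak g_0=\mathrm{Lie}(G)$, $\mathfrak g=\mathfrak g_0\otimes_{\mathbb R}\mathbb C$; $\sigma_0,\sigma_c$ also denote the induced conjugate-linear maps on $\mathfrak g$. A $(\mathfrak g,K(\mathbb C))$-module is the same as a $(\mathfrak g,K)$-module, with the $K$-action extended algebraically to $K(\mathbb C)$. $G$ is equal rank if $G$ and $K$ have the same rank (equivalently $\theta$ is an inner automorphism). A strong involution for an equal rank $G$ is $x\in G$ with $\mathrm{Ad}(x)=\theta$ and $K=G^x$; then $x\in Z(K)$ and $z=x^2\in Z(G)\cap K$. $\widehat K_\zeta$ is the set of irreducible representations of $K$ in which $z$ acts by $\zeta$; for $\mu\in\widehat K_\zeta$, $\epsilon(\mu)\in\{\pm1\}$ is defined by $\mu(x)=\epsilon(\mu)\zeta^{1/2}$. A $c$-invariant (resp. invariant) Hermitian form on a $(\mathfrak g,K)$-module satisfies $\langle kv,w\rangle=\langle v,k^{-1}w\rangle$ ($k\in K$) and $\langle Xv,w\rangle=-\langle v,\sigma(X)w\rangle$ ($X\in\mathfrak g$) with $\sigma=\sigma_c$ (resp. $\sigma=\sigma_0$). For an irreducible $\mu$ of $K$ on $E_\mu$ with a fixed unitary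 structure, $J^\mu=\mathrm{Hom}_K(E_\mu,J)$ with the Hermitian form induced from the form on $J$; $\mathrm{pos}(\mu)$ and $\mathrm{neg}(\mu)$ are the dimensions of maximal positive and negative definite subspaces of $J^\mu$. Superscripts $c$, $0$ refer to $\langle,\rangle_J^c$, $\langle,\rangle_J^0$. *)

theory Defs
  imports "HOL-Analysis.Analysis" "HOL-Library.Function_Algebras" "HOL-Library.Extended_Nat"
begin

section \<open>Linear algebraic groups over the complex numbers\<close>

type_synonym 'n cmat = "complex ^ 'n ^ 'n"

text \<open>The ring of regular functions on the general linear group: polynomials in the
  matrix entries and the inverse of the determinant.\<close>

inductive regular_GL :: "('n::finite cmat \<Rightarrow> complex) \<Rightarrow> bool" where
  const: "regular_GL (\<lambda>g. c)"
| entry: "regular_GL (\<lambda>g. g $ i $ j)"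
| inv_det: "regular_GL (\<lambda>g. inverse (det g))"
| add: "regular_GL f \<Longrightarrow> regular_GL h \<Longrightarrow> regular_GL (\<lambda>g. f g + h g)"
| mult: "regular_GL f \<Longrightarrow> regular_GL h \<Longrightarrow> regular_GL (\<lambda>g. f g * h g)"

definition regular_on :: "'n::finite cmat set \<Rightarrow> ('n cmat \<Rightarrow> complex) \<Rightarrow> bool" where
  "regular_on H f \<longleftrightarrow> (\<exists>p. regular_GL p \<and> (\<forall>g\<in>H. f g = p g))"

definition matrix_group :: "'n::finite cmat set \<Rightarrow> bool" where
  "matrix_group H \<longleftrightarrow>
     (\<forall>g\<in>H. invertible g) \<and> mat 1 \<in> H \<and>
     (\<forall>g\<in>H. \<forall>h\<in>H. g ** h \<in> H) \<and> (\<forall>g\<in>H. matrix_inv g \<in> H)"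

definition algebraic_group :: "'n::finite cmat set \<Rightarrow> bool" where
  "algebraic_group H \<longleftrightarrow> matrix_group H \<and>
     (\<exists>P. (\<forall>p\<in>P. regular_GL p) \<and> H = {g. invertible g \<and> (\<forall>p\<in>P. p g = 0)})"

definition matpow :: "'n::finite cmat \<Rightarrow> nat \<Rightarrow> 'n cmat" where
  "matpow X k = ((\<lambda>Y. X ** Y) ^^ k) (mat 1)"

definition unipotent :: "'n::finite cmat \<Rightarrow> bool" where
  "unipotent u \<longleftrightarrow> (\<exists>k. matpow (u - mat 1) k = 0)"

text \<open>Reductive means that the unipotent radical is trivial.  Connectedness refers to the
  classical topology; for complex algebraic groups it agrees with Zariski connectedness.\<close>

definition connected_reductive_group :: "'n::finite cmat set \<Rightarrow> bool" where
  "connected_reductive_group H \<longleftrightarrow> algebraic_group H \<and> connected H \<and>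
     (\<forall>U. U \<subseteq> H \<and> algebraic_group U \<and> connected U \<and>
          (\<forall>g\<in>H. \<forall>u\<in>U. g ** u ** matrix_inv g \<in> U) \<and> (\<forall>u\<in>U. unipotent u)
        \<longrightarrow> U = {mat 1})"


section \<open>Real forms\<close>

text \<open>\<open>mat c ** X\<close> is the complex scalar multiple \<open>c X\<close>.\<close>

definition antiholomorphic_on :: "'n::finite cmat set \<Rightarrow> ('n cmat \<Rightarrow> 'n cmat) \<Rightarrow> bool" where
  "antiholomorphic_on S f \<longleftrightarrow>
     (\<forall>g\<in>S. \<exists>U F. open U \<and> g \<in> U \<and> (\<forall>h\<in>U \<inter> S. F h = f h) \<and>
        (\<forall>h\<in>U. \<exists>F'. (F has_derivative F') (at h) \<and>
           (\<forall>X. F' (mat \<i> ** X) = mat (- \<i>) ** F' X)))"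

definition real_form :: "'n::finite cmat set \<Rightarrow> ('n cmat \<Rightarrow> 'n cmat) \<Rightarrow> bool" where
  "real_form GC \<sigma> \<longleftrightarrow>
     (\<forall>g\<in>GC. \<sigma> g \<in> GC) \<and> (\<forall>g\<in>GC. \<forall>h\<in>GC. \<sigma> (g ** h) = \<sigma> g ** \<sigma> h) \<and>
     (\<forall>g\<in>GC. \<sigma> (\<sigma> g) = g) \<and> antiholomorphic_on GC \<sigma>"

definition fixed_points :: "'a set \<Rightarrow> ('a \<Rightarrow> 'a) \<Rightarrow> 'a set" where
  "fixed_points S f = {g \<in> S. f g = g}"

definition compact_real_form :: "'n::finite cmat set \<Rightarrow> ('n cmat \<Rightarrow> 'n cmat) \<Rightarrow> bool" where
  "compact_real_form GC \<sigma> \<longleftrightarrow> real_form GC \<sigma> \<and> compact (fixed_points GC \<sigma>)"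


section \<open>Lie algebras and rank\<close>

definition mexp :: "'n::finite cmat \<Rightarrow> 'n cmat" where
  "mexp X = (\<Sum>k. (1 / fact k) *\<^sub>R matpow X k)"

definition bracket :: "'n::finite cmat \<Rightarrow> 'n cmat \<Rightarrow> 'n cmat" where
  "bracket X Y = X ** Y - Y ** X"

text \<open>For a complex group \<open>Lie GC\<close> is a complex subspace, and it is the complexification
  of \<open>Lie (fixed_points GC \<sigma>)\<close> for each real form \<open>\<sigma>\<close>.\<close>

definition Lie :: "'n::finite cmat set \<Rightarrow> 'n cmat set" where
  "Lie H = {X. \<forall>t::real. mexp (t *\<^sub>R X) \<in> H}"

definition differential :: "('n::finite cmat \<Rightarrow> 'n cmat) \<Rightarrow> 'n cmat \<Rightarrow> 'n cmat" where
  "differential \<sigma> X = vector_derivative (\<lambda>t::real. \<sigma> (mexp (t *\<^sub>R X))) (at 0)"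

text \<open>Real Lie algebras of matrices: \<open>subspace\<close>, \<open>span\<close> and \<open>dim\<close> are taken over the reals.\<close>

primrec lower_central :: "'n::finite cmat set \<Rightarrow> nat \<Rightarrow> 'n cmat set" where
  "lower_central L 0 = L"
| "lower_central L (Suc k) = span {bracket X Y |X Y. X \<in> L \<and> Y \<in> lower_central L k}"

text \<open>A Cartan subalgebra is a nilpotent subalgebra equal to its own normalizer.\<close>

definition cartan_subalgebra :: "'n::finite cmat set \<Rightarrow> 'n cmat set \<Rightarrow> bool" where
  "cartan_subalgebra L h \<longleftrightarrow>
     h \<subseteq> L \<and> subspace h \<and> (\<forall>X\<in>h. \<forall>Y\<in>h. bracket X Y \<in> h) \<and>
     (\<exists>k. lower_central h k = {0}) \<and>
     {X \<in> L. \<forall>Y\<in>h. bracket X Y \<in> h} = h"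

definition lie_rank :: "'n::finite cmat set \<Rightarrow> nat" where
  "lie_rank L = (THE d. \<exists>h. cartan_subalgebra L h \<and> dim h = d)"

definition equal_rank :: "'n::finite cmat set \<Rightarrow> 'n cmat set \<Rightarrow> bool" where
  "equal_rank G K \<longleftrightarrow> lie_rank (Lie G) = lie_rank (Lie K)"

definition strong_involution ::
  "'n::finite cmat set \<Rightarrow> 'n cmat set \<Rightarrow> 'n cmat set \<Rightarrow> ('n cmat \<Rightarrow> 'n cmat) \<Rightarrow> 'n cmat \<Rightarrow> bool"
where
  "strong_involution GC G K \<theta> x \<longleftrightarrow>
     x \<in> G \<and> (\<forall>g\<in>GC. x ** g ** matrix_inv x = \<theta> g) \<and>
     K = {g \<in> G. x ** g ** matrix_inv x = g}"


section \<open>Representations of groups and Harish-Chandra modules\<close>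

text \<open>A complex vector space is a type \<open>'v\<close> with scalar multiplication \<open>sc\<close>.\<close>

abbreviation functional :: "(complex \<Rightarrow> 'v::ab_group_add \<Rightarrow> 'v) \<Rightarrow> ('v \<Rightarrow> complex) \<Rightarrow> bool" where
  "functional sc l \<equiv> Vector_Spaces.linear sc (*) l"

definition fin_dim_subspace :: "(complex \<Rightarrow> 'v::ab_group_add \<Rightarrow> 'v) \<Rightarrow> 'v set \<Rightarrow> bool" where
  "fin_dim_subspace sc W \<longleftrightarrow> module.subspace sc W \<and> (\<exists>B. finite B \<and> module.span sc B = W)"

definition group_rep ::
  "'n::finite cmat set \<Rightarrow> (complex \<Rightarrow> 'v::ab_group_add \<Rightarrow> 'v) \<Rightarrow> ('n cmat \<Rightarrow> 'v \<Rightarrow> 'v) \<Rightarrow> bool"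
where
  "group_rep H sc \<pi> \<longleftrightarrow> vector_space sc \<and>
     (\<forall>h\<in>H. Vector_Spaces.linear sc sc (\<pi> h)) \<and> (\<forall>v. \<pi> (mat 1) v = v) \<and>
     (\<forall>g\<in>H. \<forall>h\<in>H. \<forall>v. \<pi> (g ** h) v = \<pi> g (\<pi> h v))"

text \<open>Every vector lies in a finite-dimensional invariant subspace on which the
  matrix coefficients are regular functions.\<close>

definition algebraic_rep ::
  "'n::finite cmat set \<Rightarrow> (complex \<Rightarrow> 'v::ab_group_add \<Rightarrow> 'v) \<Rightarrow> ('n cmat \<Rightarrow> 'v \<Rightarrow> 'v) \<Rightarrow> bool"
where
  "algebraic_rep H sc \<pi> \<longleftrightarrow> group_rep H sc \<pi> \<and>
     (\<forall>v. \<exists>W. v \<in> W \<and> fin_dim_subspace sc W \<and> (\<forall>h\<in>H. \<forall>w\<in>W. \<pi> h w \<in> W) \<and>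
        (\<forall>w\<in>W. \<forall>l. functional sc l \<longrightarrow> regular_on H (\<lambda>h. l (\<pi> h w))))"

definition lie_rep ::
  "'n::finite cmat set \<Rightarrow> (complex \<Rightarrow> 'v::ab_group_add \<Rightarrow> 'v) \<Rightarrow> ('n cmat \<Rightarrow> 'v \<Rightarrow> 'v) \<Rightarrow> bool"
where
  "lie_rep L sc a \<longleftrightarrow> vector_space sc \<and>
     (\<forall>X\<in>L. Vector_Spaces.linear sc sc (a X)) \<and>
     (\<forall>X\<in>L. \<forall>Y\<in>L. \<forall>v. a (X + Y) v = a X v + a Y v) \<and>
     (\<forall>X\<in>L. \<forall>c v. a (mat c ** X) v = sc c (a X v)) \<and>
     (\<forall>X\<in>L. \<forall>Y\<in>L. \<forall>v. a (bracket X Y) v = a X (a Y v) - a Y (a X v))"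

text \<open>The last condition says that the differential of the action of \<open>KC\<close> is the restriction
  of \<open>a\<close> to \<open>Lie KC\<close>.  It is tested on linear functionals since the module carries no
  topology; the orbit of \<open>v\<close> stays in a finite-dimensional subspace.\<close>

definition gK_module ::
  "'n::finite cmat set \<Rightarrow> 'n cmat set \<Rightarrow> (complex \<Rightarrow> 'v::ab_group_add \<Rightarrow> 'v)
    \<Rightarrow> ('n cmat \<Rightarrow> 'v \<Rightarrow> 'v) \<Rightarrow> ('n cmat \<Rightarrow> 'v \<Rightarrow> 'v) \<Rightarrow> bool"
where
  "gK_module GC KC sc a \<pi> \<longleftrightarrow> lie_rep (Lie GC) sc a \<and> algebraic_rep KC sc \<pi> \<and>
     (\<forall>k\<in>KC. \<forall>X\<in>Lie GC. \<forall>v. \<pi> k (a X v) = a (k ** X ** matrix_inv k) (\<pi> k v)) \<and>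
     (\<forall>X\<in>Lie KC. \<forall>v l. functional sc l \<longrightarrow>
        ((\<lambda>t::real. l (\<pi> (mexp (t *\<^sub>R X)) v)) has_vector_derivative l (a X v)) (at 0))"

definition irreducible_gK_module ::
  "'n::finite cmat set \<Rightarrow> 'n cmat set \<Rightarrow> (complex \<Rightarrow> 'v::ab_group_add \<Rightarrow> 'v)
    \<Rightarrow> ('n cmat \<Rightarrow> 'v \<Rightarrow> 'v) \<Rightarrow> ('n cmat \<Rightarrow> 'v \<Rightarrow> 'v) \<Rightarrow> bool"
where
  "irreducible_gK_module GC KC sc a \<pi> \<longleftrightarrow> gK_module GC KC sc a \<pi> \<and>
     (UNIV::'v set) \<noteq> {0} \<and>
     (\<forall>W. module.subspace sc W \<and> (\<forall>X\<in>Lie GC. \<forall>w\<in>W. a X w \<in> W) \<and>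
          (\<forall>k\<in>KC. \<forall>w\<in>W. \<pi> k w \<in> W) \<longrightarrow> W = {0} \<or> W = UNIV)"

definition irreducible_rep ::
  "'n::finite cmat set \<Rightarrow> (complex \<Rightarrow> 'e::ab_group_add \<Rightarrow> 'e) \<Rightarrow> ('n cmat \<Rightarrow> 'e \<Rightarrow> 'e) \<Rightarrow> bool"
where
  "irreducible_rep K sc \<rho> \<longleftrightarrow> group_rep K sc \<rho> \<and> fin_dim_subspace sc UNIV \<and>
     (\<forall>e l. functional sc l \<longrightarrow> continuous_on K (\<lambda>k. l (\<rho> k e))) \<and>
     (UNIV::'e set) \<noteq> {0} \<and>
     (\<forall>W. module.subspace sc W \<and> (\<forall>k\<in>K. \<forall>w\<in>W. \<rho> k w \<in> W) \<longrightarrow> W = {0} \<or> W = UNIV)"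


section \<open>Hermitian forms\<close>

text \<open>Forms are linear in the first and conjugate-linear in the second variable.\<close>

definition hermitian_form ::
  "(complex \<Rightarrow> 'v::ab_group_add \<Rightarrow> 'v) \<Rightarrow> ('v \<Rightarrow> 'v \<Rightarrow> complex) \<Rightarrow> bool" where
  "hermitian_form sc B \<longleftrightarrow>
     (\<forall>w. functional sc (\<lambda>v. B v w)) \<and> (\<forall>v w. B w v = cnj (B v w))"

text \<open>With \<open>\<sigma> = \<sigma>\<^sub>c\<close> this is a \<open>c\<close>-invariant Hermitian form, with \<open>\<sigma> = \<sigma>\<^sub>0\<close> an invariant one.\<close>

definition invariant_hermitian_form ::
  "'n::finite cmat set \<Rightarrow> 'n cmat set \<Rightarrow> ('n cmat \<Rightarrow> 'n cmat)
    \<Rightarrow> (complex \<Rightarrow> 'v::ab_group_add \<Rightarrow> 'v) \<Rightarrow> ('n cmat \<Rightarrow> 'v \<Rightarrow> 'v) \<Rightarrow> ('n cmat \<Rightarrow> 'v \<Rightarrow> 'v)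
    \<Rightarrow> ('v \<Rightarrow> 'v \<Rightarrow> complex) \<Rightarrow> bool"
where
  "invariant_hermitian_form GC K \<sigma> sc a \<pi> B \<longleftrightarrow> hermitian_form sc B \<and>
     (\<forall>k\<in>K. \<forall>v w. B (\<pi> k v) w = B v (\<pi> (matrix_inv k) w)) \<and>
     (\<forall>X\<in>Lie GC. \<forall>v w. B (a X v) w = - B v (a (differential \<sigma> X) w))"

definition unitary_structure ::
  "'n::finite cmat set \<Rightarrow> (complex \<Rightarrow> 'e::ab_group_add \<Rightarrow> 'e) \<Rightarrow> ('n cmat \<Rightarrow> 'e \<Rightarrow> 'e)
    \<Rightarrow> ('e \<Rightarrow> 'e \<Rightarrow> complex) \<Rightarrow> bool"
where
  "unitary_structure K sc \<rho> ip \<longleftrightarrow> hermitian_form sc ip \<and>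
     (\<forall>e. e \<noteq> 0 \<longrightarrow> 0 < Re (ip e e)) \<and>
     (\<forall>k\<in>K. \<forall>e f. ip (\<rho> k e) (\<rho> k f) = ip e f)"

text \<open>The multiplicity space, a subspace of the pointwise vector space of functions.\<close>

definition Hom_K ::
  "'n::finite cmat set \<Rightarrow> (complex \<Rightarrow> 'e::ab_group_add \<Rightarrow> 'e) \<Rightarrow> ('n cmat \<Rightarrow> 'e \<Rightarrow> 'e)
    \<Rightarrow> (complex \<Rightarrow> 'v::ab_group_add \<Rightarrow> 'v) \<Rightarrow> ('n cmat \<Rightarrow> 'v \<Rightarrow> 'v) \<Rightarrow> ('e \<Rightarrow> 'v) set"
where
  "Hom_K K scE \<rho> sc \<pi> =
     {\<phi>. Vector_Spaces.linear scE sc \<phi> \<and> (\<forall>k\<in>K. \<forall>e. \<phi> (\<rho> k e) = \<pi> k (\<phi> e))}"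

definition fun_scale :: "(complex \<Rightarrow> 'v \<Rightarrow> 'v) \<Rightarrow> complex \<Rightarrow> ('e \<Rightarrow> 'v) \<Rightarrow> ('e \<Rightarrow> 'v)" where
  "fun_scale sc c \<phi> = (\<lambda>e. sc c (\<phi> e))"

text \<open>By Schur's lemma the form \<open>B (\<phi> e) (\<psi> f)\<close> on \<open>E\<close> is a multiple of the unitary structure
  \<open>ip\<close>; the multiple is the value of the induced form.  Thus \<open>B\<close> on the \<open>\<mu>\<close>-isotypic part
  \<open>E \<otimes> Hom_K(E, J)\<close> is the tensor product of \<open>ip\<close> with this form.\<close>

definition mult_form ::
  "('e \<Rightarrow> 'e \<Rightarrow> complex) \<Rightarrow> ('v \<Rightarrow> 'v \<Rightarrow> complex) \<Rightarrow> ('e \<Rightarrow> 'v) \<Rightarrow> ('e \<Rightarrow> 'v) \<Rightarrow> complex" where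
  "mult_form ip B \<phi> \<psi> = (THE c. \<forall>e f. B (\<phi> e) (\<psi> f) = c * ip e f)"

text \<open>The dimension of a maximal positive (negative) definite subspace of \<open>V\<close>.  It is a
  supremum over the finite-dimensional ones so that it is meaningful for every \<open>V\<close>.\<close>

definition pos_dim ::
  "(complex \<Rightarrow> 'v::ab_group_add \<Rightarrow> 'v) \<Rightarrow> 'v set \<Rightarrow> ('v \<Rightarrow> 'v \<Rightarrow> complex) \<Rightarrow> enat" where
  "pos_dim sc V Q = Sup {enat (vector_space.dim sc S) |S.
     fin_dim_subspace sc S \<and> S \<subseteq> V \<and> (\<forall>v\<in>S. v \<noteq> 0 \<longrightarrow> 0 < Re (Q v v))}"

definition neg_dim ::
  "(complex \<Rightarrow> 'v::ab_group_add \<Rightarrow> 'v) \<Rightarrow> 'v set \<Rightarrow> ('v \<Rightarrow> 'v \<Rightarrow> complex) \<Rightarrow> enat" where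
  "neg_dim sc V Q = Sup {enat (vector_space.dim sc S) |S.
     fin_dim_subspace sc S \<and> S \<subseteq> V \<and> (\<forall>v\<in>S. v \<noteq> 0 \<longrightarrow> Re (Q v v) < 0)}"

definition signature ::
  "'n::finite cmat set \<Rightarrow> (complex \<Rightarrow> 'e::ab_group_add \<Rightarrow> 'e) \<Rightarrow> ('n cmat \<Rightarrow> 'e \<Rightarrow> 'e)
    \<Rightarrow> ('e \<Rightarrow> 'e \<Rightarrow> complex) \<Rightarrow> (complex \<Rightarrow> 'v::ab_group_add \<Rightarrow> 'v) \<Rightarrow> ('n cmat \<Rightarrow> 'v \<Rightarrow> 'v)
    \<Rightarrow> ('v \<Rightarrow> 'v \<Rightarrow> complex) \<Rightarrow> enat \<times> enat"
where
  "signature K scE \<rho> ip sc \<pi> B =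
     (pos_dim (fun_scale sc) (Hom_K K scE \<rho> sc \<pi>) (mult_form ip B),
      neg_dim (fun_scale sc) (Hom_K K scE \<rho> sc \<pi>) (mult_form ip B))"

text \<open>The sign \<open>\<epsilon>(\<mu>)\<close> with \<open>\<mu>(x) = \<epsilon>(\<mu>) s\<close>, where \<open>s\<close> is the chosen square root of \<open>\<zeta>\<close>.\<close>

definition eps ::
  "(complex \<Rightarrow> 'e \<Rightarrow> 'e) \<Rightarrow> ('n::finite cmat \<Rightarrow> 'e \<Rightarrow> 'e) \<Rightarrow> 'n cmat \<Rightarrow> complex \<Rightarrow> int" where
  "eps scE \<rho> x s = (THE \<epsilon>. \<epsilon> \<in> {1, -1} \<and> (\<forall>e. \<rho> x e = scE (of_int \<epsilon> * s) e))"

end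

theory Submission
  imports Defs "HOL-Computational_Algebra.Fundamental_Theorem_Algebra"
begin

text \<open>Since \<open>\<sigma>\<^sub>c \<circ> Ad x = \<sigma>\<^sub>c \<circ> \<theta> = \<sigma>\<^sub>0\<close>, moving \<open>x\<close> past \<open>X\<close> in \<open>Bc (x X v) w\<close> turns
  \<open>c\<close>-invariance into invariance.  The form \<open>B0\<close> is Hermitian because \<open>x\<inverse>\<close> acts as
  \<open>\<zeta>\<inverse> x\<close> and \<open>\<bar>\<zeta>\<bar> = 1\<close> unless \<open>Bc = 0\<close>: the element \<open>z \<in> K\<close> preserves \<open>Bc\<close> and
  multiplies it by \<open>\<bar>\<zeta>\<bar>\<^sup>2\<close>.  On \<open>E\<close> the element \<open>x\<close> is central with square \<open>\<zeta>\<close>, so by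
  irreducibility it is \<open>\<plusminus>s\<close>, which gives the sign relating the forms on the multiplicity
  spaces.\<close>

section \<open>Matrix groups and conjugation\<close>

lemma invertible_right_inverse: "invertible (A :: 'n::finite cmat) \<Longrightarrow> A ** matrix_inv A = mat 1"
  and invertible_left_inverse: "invertible (A :: 'n::finite cmat) \<Longrightarrow> matrix_inv A ** A = mat 1"
proof -
  assume "invertible A"
  then have "A ** matrix_inv A = mat 1 \<and> matrix_inv A ** A = mat 1"
    unfolding invertible_def matrix_inv_def by (rule someI_ex)
  then show "A ** matrix_inv A = mat 1" "matrix_inv A ** A = mat 1" by auto
qed

text \<open>A bilinear map on finite-dimensional spaces is bounded. This supplies the constant in
  the estimate of matrix powers and the continuity of conjugation.\<close>

lemma bounded_bilinear_matrix_mult: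
  "bounded_bilinear ((**) :: 'n::finite cmat \<Rightarrow> 'n cmat \<Rightarrow> 'n cmat)"
proof -
  have "(A + B) ** C = A ** C + B ** C" for A B C :: "'n cmat"
    by (vector matrix_matrix_mult_def sum.distrib[symmetric] field_simps)
  then show ?thesis
    unfolding bilinear_conv_bounded_bilinear[symmetric] bilinear_def
  by (auto intro!: linearI simp: matrix_add_ldistrib matrix_scalar_ac
      simp flip: scalar_matrix_assoc)
qed

section \<open>Matrix powers and the exponential under conjugation\<close>

lemma matpow_0 [simp]: "matpow X 0 = mat 1"
  and matpow_Suc [simp]: "matpow X (Suc k) = X ** matpow X k"
  by (simp_all add: matpow_def)

text \<open>Comparison with the scalar exponential series: boundedness of the product gives
  \<open>norm (matpow X k) \<le> c * (M * norm X) ^ k\<close>, where \<open>M\<close> makes up for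
  the norm not being known to be submultiplicative.\<close>

lemma summable_mexp: "summable (\<lambda>k. (1 / fact k) *\<^sub>R matpow (X :: 'n::finite cmat) k)"
proof -
  from bounded_bilinear.pos_bounded[OF bounded_bilinear_matrix_mult[where 'n = 'n]]
  obtain M where M: "M > 0" "\<forall>(A :: 'n cmat) (B :: 'n cmat). norm (A ** B) \<le> norm A * norm B * M"
    by auto
  define c where "c = norm (mat 1 :: 'n cmat)"
  have pow: "norm (matpow X k) \<le> c * (M * norm X) ^ k" for k
  proof (induction k)
    case (Suc k)
    have "norm (matpow X (Suc k)) \<le> (M * norm X) * norm (matpow X k)"
      using M(2)[rule_format, of X "matpow X k"] by (simp add: mult_ac)
    also have "\<dots> \<le> (M * norm X) * (c * (M * norm X) ^ k)"
      using Suc M(1) by (intro mult_left_mono) auto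
    finally show ?case by (simp add: mult_ac)
  qed (simp add: c_def)
  have "summable (\<lambda>k. c * (inverse (fact k) * (M * norm X) ^ k))"
    by (intro summable_mult summable_exp)
  moreover have "norm ((1 / fact k) *\<^sub>R matpow X k) \<le> c * (inverse (fact k) * (M * norm X) ^ k)" for k
    using mult_left_mono[OF pow[of k], of "inverse (fact k)"] by (simp add: inverse_eq_divide)
  ultimately show ?thesis by (rule summable_comparison_test'[where N = 0])
qed

text \<open>Conjugation by \<open>x\<close> is multiplicative, so it commutes with powers, and
  bounded linear, so it passes through the convergent series.\<close>

lemma mexp_conj:
  fixes x :: "'n::finite cmat"
  assumes "invertible x"
  shows "mexp (x ** X ** matrix_inv x) = x ** mexp X ** matrix_inv x"
proof -
  have pow: "matpow (x ** X ** matrix_inv x) k = x ** matpow X k ** matrix_inv x" for k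
  proof (induction k)
    case (Suc k)
    have "(x ** X ** matrix_inv x) ** (x ** matpow X k ** matrix_inv x)
        = x ** X ** (matrix_inv x ** x) ** matpow X k ** matrix_inv x"
      by (simp add: matrix_mul_assoc)
    then show ?case
      using Suc by (simp add: invertible_left_inverse[OF assms] matrix_mul_assoc)
  qed (simp add: invertible_right_inverse[OF assms])
  have bl: "bounded_linear (\<lambda>Y. x ** Y ** matrix_inv x)"
    using bounded_linear_compose[OF
        bounded_bilinear.bounded_linear_left[OF bounded_bilinear_matrix_mult]
        bounded_bilinear.bounded_linear_right[OF bounded_bilinear_matrix_mult]] .
  have "x ** mexp X ** matrix_inv x
      = (\<Sum>k. x ** ((1 / fact k) *\<^sub>R matpow X k) ** matrix_inv x)"
    unfolding mexp_def by (rule bounded_linear.suminf[OF bl summable_mexp])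
  then show ?thesis
    unfolding mexp_def[of "x ** X ** matrix_inv x"]
    unfolding pow matrix_scalar_ac scalar_matrix_assoc by (rule sym)
qed

lemma matrix_inv_unique_right:
  assumes "invertible (A :: 'n::finite cmat)" "A ** B = mat 1"
  shows "matrix_inv A = B"
proof -
  have "matrix_inv A = (matrix_inv A ** A) ** B"
    using assms(2) by (simp flip: matrix_mul_assoc)
  then show ?thesis by (simp add: invertible_left_inverse[OF assms(1)])
qed

section \<open>Fixed-point subgroups and Lie algebras\<close>

lemma matrix_groupD:
  assumes "matrix_group H"
  shows "mat 1 \<in> H"
    and "g \<in> H \<Longrightarrow> invertible g"
    and "g \<in> H \<Longrightarrow> matrix_inv g \<in> H"
    and "g \<in> H \<Longrightarrow> h \<in> H \<Longrightarrow> g ** h \<in> H"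
  using assms by (simp_all add: matrix_group_def)

lemma matrix_group_fixed_points:
  assumes H: "matrix_group H" and f: "\<And>g h. g \<in> H \<Longrightarrow> h \<in> H \<Longrightarrow> f (g ** h) = f g ** f h"
    and inv: "\<And>g. g \<in> H \<Longrightarrow> f g \<in> H"
  shows "matrix_group (fixed_points H f)"
proof -
  have 1: "mat 1 \<in> H" using H by (simp add: matrix_group_def)
  have f1: "f (mat 1) = mat 1"
  proof -
    \<comment> \<open>The image of the identity is idempotent, and an invertible idempotent is the
      identity.\<close>
    have "invertible (f (mat 1))" using matrix_groupD[OF H] inv 1 by blast
    moreover have "f (mat 1) ** f (mat 1) = f (mat 1)" using f[OF 1 1] by simp
    ultimately show ?thesis
      using invertible_left_inverse[of "f (mat 1)"]
        matrix_mul_assoc[of "matrix_inv (f (mat 1))" "f (mat 1)" "f (mat 1)"] by simp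
  qed
  have "f (matrix_inv g) = matrix_inv g" if "g \<in> H" "f g = g" for g
  proof -
    have g: "invertible g" "matrix_inv g \<in> H" using matrix_groupD[OF H] that by auto
    then have "g ** f (matrix_inv g) = mat 1"
      using f[OF that(1) g(2)] that f1 by (simp add: invertible_right_inverse)
    then show ?thesis by (rule matrix_inv_unique_right[OF g(1), symmetric])
  qed
  then show ?thesis
    unfolding matrix_group_def fixed_points_def using matrix_groupD[OF H] f f1 by simp
qed

lemma mexp_scaleR_conj:
  fixes x :: "'n::finite cmat"
  assumes "invertible x"
  shows "mexp (t *\<^sub>R (x ** X ** matrix_inv x)) = x ** mexp (t *\<^sub>R X) ** matrix_inv x"
proof -
  have "x ** (t *\<^sub>R X) ** matrix_inv x = t *\<^sub>R (x ** X ** matrix_inv x)"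
    unfolding matrix_scalar_ac scalar_matrix_assoc ..
  with mexp_conj[OF assms, of "t *\<^sub>R X"] show ?thesis by (simp only:)
qed

lemma conj_in_Lie:
  assumes H: "matrix_group H" and x: "x \<in> H" and X: "X \<in> Lie H"
  shows "x ** X ** matrix_inv x \<in> Lie H"
proof -
  have inv: "invertible x" using matrix_groupD[OF H] x by blast
  show ?thesis
    using matrix_groupD[OF H] x X by (simp add: Lie_def mexp_scaleR_conj[OF inv])
qed

text \<open>Both sides differentiate the same curve: conjugation passes through \<open>mexp\<close>,
  and the curve \<open>mexp (t *\<^sub>R X)\<close> stays in \<open>H\<close>, where the two maps
  are related.\<close>

lemma differential_conj:
  assumes H: "matrix_group H" and x: "x \<in> H" and X: "X \<in> Lie H"
    and \<sigma>: "\<And>g. g \<in> H \<Longrightarrow> \<sigma> (x ** g ** matrix_inv x) = \<tau> g"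
  shows "differential \<sigma> (x ** X ** matrix_inv x) = differential \<tau> X"
proof -
  have inv: "invertible x" using matrix_groupD[OF H] x by blast
  show ?thesis
    using \<sigma> X by (simp add: differential_def Lie_def mexp_scaleR_conj[OF inv])
qed

section \<open>Eigenvectors\<close>

text \<open>The vector \<open>p(T) v\<close> in Horner form, so that an induction along the
  coefficients of \<open>p\<close> matches the definition.\<close>

definition poly_apply ::
  "('a::field \<Rightarrow> 'v::ab_group_add \<Rightarrow> 'v) \<Rightarrow> ('v \<Rightarrow> 'v) \<Rightarrow> 'v \<Rightarrow> 'a poly \<Rightarrow> 'v" where
  "poly_apply sc T v p = fold_coeffs (\<lambda>c w. sc c v + T w) p 0"

context vector_space
begin

lemma poly_apply_pCons:
  assumes "Vector_Spaces.linear scale scale T"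
  shows "poly_apply scale T v (pCons c p) = scale c v + T (poly_apply scale T v p)"
proof -
  interpret T: Vector_Spaces.linear scale scale T by fact
  show ?thesis
    by (cases "c = 0 \<and> p = 0") (auto simp: poly_apply_def)
qed

lemma poly_apply_0 [simp]: "poly_apply scale T v 0 = 0"
  by (simp add: poly_apply_def)

lemma poly_apply_add:
  assumes T: "Vector_Spaces.linear scale scale T"
  shows "poly_apply scale T v (p + q) = poly_apply scale T v p + poly_apply scale T v q"
proof (induction p q rule: poly_induct2)
  case (pCons a p b q)
  interpret T: Vector_Spaces.linear scale scale T by fact
  from pCons show ?case
    by (simp add: poly_apply_pCons[OF T] T.add scale_left_distrib)
qed simp

lemma poly_apply_smult:
  assumes T: "Vector_Spaces.linear scale scale T"
  shows "poly_apply scale T v (smult c p) = scale c (poly_apply scale T v p)"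
proof (induction p)
  case (pCons a p)
  interpret T: Vector_Spaces.linear scale scale T by fact
  from pCons show ?case
    by (simp add: poly_apply_pCons[OF T] T.scale scale_right_distrib)
qed simp

lemma poly_apply_monom:
  assumes T: "Vector_Spaces.linear scale scale T"
  shows "poly_apply scale T v (monom c k) = scale c ((T ^^ k) v)"
proof (induction k)
  case (Suc k)
  interpret T: Vector_Spaces.linear scale scale T by fact
  from Suc show ?case
    by (simp add: poly_apply_pCons[OF T] T.scale monom_Suc)
next
  case 0
  interpret T: Vector_Spaces.linear scale scale T by fact
  show ?case by (simp add: poly_apply_pCons[OF T] monom_0)
qed

lemma poly_apply_sum:
  assumes T: "Vector_Spaces.linear scale scale T"
  shows "poly_apply scale T v (\<Sum>i\<in>I. p i) = (\<Sum>i\<in>I. poly_apply scale T v (p i))"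
  by (induction I rule: infinite_finite_induct) (simp_all add: poly_apply_add[OF T])

text \<open>Among \<open>v, T v, ..., T^d v\<close> with \<open>d = card B\<close> there are too
  many vectors to be independent. Dependence is a notion for sets, so repetitions are treated apart:
  if \<open>T^i v = T^j v\<close> with \<open>i \<noteq> j\<close>, the polynomial
  \<open>X^i - X^j\<close> serves.\<close>

lemma exists_annihilating_poly:
  assumes T: "Vector_Spaces.linear scale scale T" and B: "finite B" "span B = UNIV"
  shows "\<exists>p. p \<noteq> 0 \<and> poly_apply scale T v p = 0"
proof (cases "inj_on (\<lambda>i. (T ^^ i) v) {..card B}")
  case True
  let ?S = "(\<lambda>i. (T ^^ i) v) ` {..card B}"
  have "card ?S = Suc (card B)" using True by (simp add: card_image)
  then have "dependent ?S"
    using independent_span_bound[OF B(1), of ?S] B(2) by fastforce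
  then obtain u w where u: "(\<Sum>w\<in>?S. scale (u w) w) = 0" and w: "w \<in> ?S" "u w \<noteq> 0"
    by (auto simp: dependent_finite)
  then obtain k where k: "k \<le> card B" "u ((T ^^ k) v) \<noteq> 0" by auto
  \<comment> \<open>The coefficients \<open>u\<close> are indexed by vectors; injectivity of the
    orbit map lets them be read as coefficients indexed by exponents.\<close>
  define p where "p = (\<Sum>i\<le>card B. monom (u ((T ^^ i) v)) i)"
  have "coeff p k \<noteq> 0"
    using k by (simp add: p_def coeff_sum)
  then have "p \<noteq> 0" by (metis coeff_0)
  moreover have "poly_apply scale T v p = 0"
    using u by (simp add: p_def poly_apply_sum[OF T] poly_apply_monom[OF T] sum.reindex[OF True])
  ultimately show ?thesis by blast
next
  case False
  then obtain i j where ij: "i \<noteq> j" "(T ^^ i) v = (T ^^ j) v" by (auto simp: inj_on_def)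
  let ?p = "monom 1 i + monom (-1) j :: 'a poly"
  have "coeff ?p i \<noteq> 0" using ij by simp
  then have "?p \<noteq> 0" by (metis coeff_0)
  moreover have "poly_apply scale T v ?p = 0"
    using ij by (simp only: poly_apply_add[OF T] poly_apply_monom[OF T]) simp
  ultimately show ?thesis by blast
qed

end

text \<open>Split off a root: \<open>p = (X - c) q\<close>. Either \<open>q(T) v\<close> is nonzero,
  and then it is an eigenvector for \<open>c\<close>, or \<open>q\<close> annihilates
  \<open>v\<close> in smaller degree. A nonzero constant cannot annihilate
  \<open>v \<noteq> 0\<close>.\<close>

lemma eigenvector_of_annihilating_poly:
  fixes sc :: "'a::alg_closed_field \<Rightarrow> 'v::ab_group_add \<Rightarrow> 'v"
  assumes T: "Vector_Spaces.linear sc sc T" and v: "v \<noteq> 0"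
  shows "p \<noteq> 0 \<Longrightarrow> poly_apply sc T v p = 0 \<Longrightarrow> \<exists>c w. w \<noteq> 0 \<and> T w = sc c w"
proof (induction "degree p" arbitrary: p)
  case 0
  interpret T: Vector_Spaces.linear sc sc T by fact
  from 0 obtain c where "p = [:c:]" "c \<noteq> 0" by (metis degree_0_id pCons_eq_0_iff)
  with 0 v show ?case by (simp add: T.vs1.poly_apply_pCons[OF T])
next
  case (Suc n)
  interpret T: Vector_Spaces.linear sc sc T by fact
  obtain c where "poly p c = 0" using alg_closed_imp_poly_has_root[of p] Suc by auto
  then obtain q where q: "p = [:- c, 1:] * q" by (auto simp: poly_eq_0_iff_dvd)
  with Suc.prems have "q \<noteq> 0" by auto
  then have deg: "n = degree q" using q Suc.hyps(2) by (simp add: degree_mult_eq del: mult_pCons_left)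
  have "p = smult (- c) q + pCons 0 q" by (simp add: q)
  then have "T (poly_apply sc T v q) = sc c (poly_apply sc T v q)"
    using Suc.prems(2)
    by (simp only: T.vs1.poly_apply_add[OF T] T.vs1.poly_apply_smult[OF T]
        T.vs1.poly_apply_pCons[OF T]) simp
  then show ?case
    using Suc.hyps(1)[OF deg \<open>q \<noteq> 0\<close>] by blast
qed

lemma eigenvector_exists:
  fixes sc :: "'a::alg_closed_field \<Rightarrow> 'v::ab_group_add \<Rightarrow> 'v"
  assumes T: "Vector_Spaces.linear sc sc T" and "(UNIV :: 'v set) \<noteq> {0}"
    and "finite B" "module.span sc B = UNIV"
  obtains c v where "v \<noteq> 0" "T v = sc c v"
proof -
  interpret T: Vector_Spaces.linear sc sc T by fact
  obtain v :: 'v where v: "v \<noteq> 0" using assms by auto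
  with T.vs1.exists_annihilating_poly[OF T assms(3,4), of v] show ?thesis
    using eigenvector_of_annihilating_poly[OF T v] that by metis
qed


section \<open>Schur's lemma for forms\<close>

text \<open>Here \<open>b\<close> and \<open>b'\<close> stand for forms with the first argument
  fixed. Conjugating turns them into linear functionals, which are determined on a spanning
  set.\<close>

lemma sesquilinear_eq_on_basis:
  assumes "functional sc (\<lambda>f. cnj (b f))" "functional sc (\<lambda>f. cnj (b' f))"
    and "module.span sc B = UNIV" "\<And>f. f \<in> B \<Longrightarrow> b f = b' f"
  shows "b f = b' f"
proof -
  interpret b: Vector_Spaces.linear sc "(*)" "\<lambda>f. cnj (b f)" by fact
  interpret b': Vector_Spaces.linear sc "(*)" "\<lambda>f. cnj (b' f)" by fact
  interpret vector_space_pair sc "(*) :: complex \<Rightarrow> complex \<Rightarrow> complex" ..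
  have "cnj (b f) = cnj (b' f)"
    by (rule linear_eq_on[OF assms(1,2), of f B]) (use assms in auto)
  then show ?thesis by simp
qed

lemma hermitian_form_sesquilinear:
  assumes "hermitian_form sc B"
  shows "functional sc (\<lambda>v. B v w)" "functional sc (\<lambda>w. cnj (B v w))"
proof -
  have lin: "functional sc (\<lambda>v. B v w)" for w
    using assms unfolding hermitian_form_def by blast
  then show "functional sc (\<lambda>v. B v w)" .
  have "(\<lambda>w. cnj (B v w)) = (\<lambda>w. B w v)"
    using assms unfolding hermitian_form_def by metis
  then show "functional sc (\<lambda>w. cnj (B v w))" using lin[of v] by (simp only:)
qed

text \<open>Nondegeneracy of \<open>g\<close> in finite dimension yields an operator
  \<open>T\<close> with \<open>b e f = g (T e) f\<close>. An eigenvector of \<open>T\<close> is the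
  required \<open>v\<close>, with its eigenvalue as \<open>c\<close>.\<close>

lemma generalized_eigenvector_exists:
  fixes sc :: "complex \<Rightarrow> 'e::ab_group_add \<Rightarrow> 'e"
  assumes fin: "fin_dim_subspace sc UNIV" and nz: "(UNIV :: 'e set) \<noteq> {0}"
    and vs: "vector_space sc"
    and b1: "\<And>f. functional sc (\<lambda>e. b e f)" and b2: "\<And>e. functional sc (\<lambda>f. cnj (b e f))"
    and g1: "\<And>f. functional sc (\<lambda>e. g e f)" and g2: "\<And>e. functional sc (\<lambda>f. cnj (g e f))"
    and nondeg: "\<And>e. (\<And>f. g e f = 0) \<Longrightarrow> e = 0"
  obtains c v where "v \<noteq> 0" "\<And>f. b v f = c * g v f"
proof -
  interpret vs: vector_space sc by fact
  obtain B0 where B0: "finite B0" "vs.span B0 = UNIV"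
    using fin by (auto simp: fin_dim_subspace_def)
  \<comment> \<open>\<open>fin_dim_subspace\<close> provides only a finite spanning set; a basis
    inside it is needed to compare coordinates.\<close>
  obtain B where B: "B \<subseteq> B0" "vs.independent B" "B0 \<subseteq> vs.span B"
    using vs.maximal_independent_subset[of B0] by blast
  have span: "vs.span B = UNIV"
    using vs.span_mono[OF B(3)] B0(2) by (auto simp: vs.span_span)
  have finB: "finite B" using B(1) B0(1) finite_subset by blast
  interpret fd: finite_dimensional_vector_space sc B
    by unfold_locales (use finB B span in auto)
  have coeff: "u f = w f"
    if "(\<Sum>f\<in>B. sc (u f) f) = (\<Sum>f\<in>B. sc (w f) f)" "f \<in> B" for u w f
  proof -
    have "(\<Sum>f\<in>B. sc (u f - w f) f) = 0"
      using that(1) by (simp add: vs.scale_left_diff_distrib sum_subtractf)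
    then show ?thesis
      using vs.independentD[OF B(2) finB order_refl, of "\<lambda>f. u f - w f"] that(2) by force
  qed
  text \<open>\<open>A\<close> and \<open>C\<close> record the values of the two forms on the basis as coordinates, so that
    \<open>T = A\<inverse> \<circ> C\<close> represents \<open>b\<close> with respect to \<open>g\<close>.\<close>
  define A C where "A e = (\<Sum>f\<in>B. sc (g e f) f)" and "C e = (\<Sum>f\<in>B. sc (b e f) f)" for e
  have A: "Vector_Spaces.linear sc sc A" and C: "Vector_Spaces.linear sc sc C"
    using b1 g1 vs unfolding Vector_Spaces.linear_iff A_def C_def
    by (simp_all add: vs.scale_left_distrib sum.distrib vs.scale_sum_right)
  interpret A: Vector_Spaces.linear sc sc A by fact
  interpret C: Vector_Spaces.linear sc sc C by fact
  have "inj A"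
  proof (subst A.inj_iff_eq_0, intro allI impI)
    fix e assume "A e = 0"
    then have "g e f = 0" if "f \<in> B" for f
      using coeff[of "g e" "\<lambda>_. 0" f] that by (simp add: A_def)
    then have "g e f = 0" for f
      using sesquilinear_eq_on_basis[OF g2[of e] _ span, of "\<lambda>_. 0" f] g2[of e]
      by (simp add: Vector_Spaces.linear_iff)
    then show "e = 0" by (rule nondeg)
  qed
  then have surj: "surj A" by (rule fd.linear_inj_imp_surj[OF A])
  define T where "T e = inv A (C e)" for e
  have AT: "A (T e) = C e" for e
    using surj by (simp add: T_def surj_f_inv_f)
  \<comment> \<open>Since \<open>A\<close> is injective, linearity of \<open>T\<close> can be
    checked after applying \<open>A\<close>.\<close>
  have "T (e + f) = T e + T f" "T (sc c e) = sc c (T e)" for c e f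
    by (rule injD[OF \<open>inj A\<close>], simp add: AT A.add A.scale C.add C.scale)+
  then have "Vector_Spaces.linear sc sc T"
    using vs by (simp add: Vector_Spaces.linear_iff)
  from eigenvector_exists[OF this nz B0]
  obtain c v where v: "v \<noteq> 0" "T v = sc c v" .
  have "A (sc c v) = C v" using AT[of v] v(2) by simp
  then have "b v f = c * g v f" if "f \<in> B" for f
    using coeff[of "\<lambda>f. g (sc c v) f" "b v" f] that g1[of f]
    by (simp add: A_def C_def Vector_Spaces.linear_iff)
  then have "b v f = c * g v f" for f
    using sesquilinear_eq_on_basis[OF b2[of v] _ span, of "\<lambda>f. c * g v f" f] g2[of v] vs
    by (simp add: Vector_Spaces.linear_iff algebra_simps)
  with v(1) show ?thesis by (rule that)
qed

section \<open>Group representations and consequences of irreducibility\<close>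

lemma group_repD:
  assumes "group_rep H sc \<pi>"
  shows "vector_space sc"
    and "h \<in> H \<Longrightarrow> \<pi> h (v + w) = \<pi> h v + \<pi> h w"
    and "h \<in> H \<Longrightarrow> \<pi> h (sc c v) = sc c (\<pi> h v)"
    and "\<pi> (mat 1) v = v"
    and "g \<in> H \<Longrightarrow> h \<in> H \<Longrightarrow> \<pi> (g ** h) v = \<pi> g (\<pi> h v)"
  using assms by (simp_all add: group_rep_def Vector_Spaces.linear_iff)

lemma group_rep_inv:
  assumes "group_rep H sc \<pi>" "matrix_group H" "h \<in> H"
  shows "\<pi> h (\<pi> (matrix_inv h) v) = v" "\<pi> (matrix_inv h) (\<pi> h v) = v"
proof -
  have h: "matrix_inv h \<in> H" "invertible h" using matrix_groupD[OF assms(2)] assms(3) by blast+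
  show "\<pi> h (\<pi> (matrix_inv h) v) = v" "\<pi> (matrix_inv h) (\<pi> h v) = v"
    using group_repD(5)[OF assms(1,3) h(1), of v] group_repD(5)[OF assms(1) h(1) assms(3), of v]
    by (simp_all add: invertible_right_inverse[OF h(2)] invertible_left_inverse[OF h(2)]
        group_repD(4)[OF assms(1)])
qed

text \<open>For a generalized eigenvalue \<open>c\<close> of \<open>b\<close> relative to
  \<open>ip\<close>, the vectors \<open>e\<close> on which \<open>b e\<close> and
  \<open>c * ip e\<close> agree form a nonzero \<open>K\<close>-stable subspace, hence all of
  \<open>E\<close>. Uniqueness of \<open>c\<close> comes from \<open>ip v v \<noteq> 0\<close>; it
  is what makes \<open>mult_form\<close> meaningful.\<close>

lemma invariant_form_multiple:
  fixes sc :: "complex \<Rightarrow> 'e::ab_group_add \<Rightarrow> 'e"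
  assumes K: "matrix_group K" and irr: "irreducible_rep K sc \<rho>"
    and ip: "unitary_structure K sc \<rho> ip"
    and b1: "\<And>f. functional sc (\<lambda>e. b e f)" and b2: "\<And>e. functional sc (\<lambda>f. cnj (b e f))"
    and inv: "\<And>k e f. k \<in> K \<Longrightarrow> b (\<rho> k e) (\<rho> k f) = b e f"
  shows "\<exists>!c. \<forall>e f. b e f = c * ip e f"
proof -
  have rep: "group_rep K sc \<rho>" and nz: "(UNIV :: 'e set) \<noteq> {0}"
    and fin: "fin_dim_subspace sc UNIV"
    and irrD: "\<And>W. module.subspace sc W \<Longrightarrow> (\<And>k w. k \<in> K \<Longrightarrow> w \<in> W \<Longrightarrow> \<rho> k w \<in> W) \<Longrightarrow>
      W = {0} \<or> W = UNIV"
    using irr by (simp_all add: irreducible_rep_def)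
  have herm: "hermitian_form sc ip" and pos: "\<And>e. e \<noteq> 0 \<Longrightarrow> ip e e \<noteq> 0"
    and ipinv: "\<And>k e f. k \<in> K \<Longrightarrow> ip (\<rho> k e) (\<rho> k f) = ip e f"
    using ip by (auto simp: unitary_structure_def)
  note ip12 = hermitian_form_sesquilinear[OF herm]
  interpret vector_space sc by (rule group_repD(1)[OF rep])
  obtain c v where cv: "v \<noteq> 0" "\<And>f. b v f = c * ip v f"
  proof (rule generalized_eigenvector_exists[OF fin nz group_repD(1)[OF rep] b1 b2 ip12])
    show "e = 0" if "\<And>f. ip e f = 0" for e using pos[of e] that by blast
  qed (rule that)
  let ?W = "{e. \<forall>f. b e f = c * ip e f}"
  have "subspace ?W"
  proof -
    have add: "b (e + e') f = b e f + b e' f" "ip (e + e') f = ip e f + ip e' f"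
      and scale: "b (sc d e) f = d * b e f" "ip (sc d e) f = d * ip e f" for d e e' f
      using b1[of f] ip12(1)[of f] unfolding Vector_Spaces.linear_iff by blast+
    have "b 0 f = 0" "ip 0 f = 0" for f
      using add[of 0 0 f] by simp_all
    then show ?thesis
      by (simp add: subspace_def add scale algebra_simps)
  qed
  moreover have "\<rho> k e \<in> ?W" if "k \<in> K" "e \<in> ?W" for k e
  proof safe
    fix f
    \<comment> \<open>Writing the second argument as a translate by \<open>k\<close> brings
      \<open>k\<close> into both slots, where invariance of the two forms applies.\<close>
    have "f = \<rho> k (\<rho> (matrix_inv k) f)" using group_rep_inv[OF rep K that(1)] by simp
    then show "b (\<rho> k e) f = c * ip (\<rho> k e) f"
      using inv[OF that(1), of e "\<rho> (matrix_inv k) f"] ipinv[OF that(1), of e "\<rho> (matrix_inv k) f"]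
        that(2) by simp
  qed
  ultimately have "?W = {0} \<or> ?W = UNIV" by (rule irrD)
  moreover have "v \<in> ?W" using cv(2) by simp
  ultimately have all: "\<forall>e f. b e f = c * ip e f" using cv(1) by blast
  show ?thesis
  proof (intro ex1I)
    show "\<forall>e f. b e f = c * ip e f" by (rule all)
    fix d assume "\<forall>e f. b e f = d * ip e f"
    then have "c * ip v v = d * ip v v" using all by metis
    then show "d = c" using pos[OF cv(1)] by simp
  qed
qed

text \<open>The \<open>s\<close>-eigenspace of the central element \<open>x\<close> is
  \<open>K\<close>-stable, so it is everything or zero. As \<open>x\<close> squares to
  \<open>s\<^sup>2\<close>, each vector \<open>\<rho> x e + s e\<close> lies in it; if it is zero,
  \<open>x\<close> acts by \<open>-s\<close>.\<close>

lemma central_square_root_sign: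
  fixes sc :: "complex \<Rightarrow> 'e::ab_group_add \<Rightarrow> 'e"
  assumes irr: "irreducible_rep K sc \<rho>" and x: "x \<in> K"
    and central: "\<And>k. k \<in> K \<Longrightarrow> x ** k = k ** x"
    and sq: "\<And>e. \<rho> (x ** x) e = sc (s\<^sup>2) e"
  obtains \<epsilon> :: int where "\<epsilon> \<in> {1, -1}" "\<And>e. \<rho> x e = sc (of_int \<epsilon> * s) e"
proof -
  have rep: "group_rep K sc \<rho>"
    and irrD: "\<And>W. module.subspace sc W \<Longrightarrow> (\<And>k w. k \<in> K \<Longrightarrow> w \<in> W \<Longrightarrow> \<rho> k w \<in> W) \<Longrightarrow>
      W = {0} \<or> W = UNIV"
    using irr by (simp_all add: irreducible_rep_def)
  note repD = group_repD[OF rep]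
  interpret vector_space sc by (rule repD(1))
  let ?W = "{e. \<rho> x e = sc s e}"
  have "\<rho> x 0 = 0" using repD(3)[OF x, of 0 0] by simp
  then have "subspace ?W"
    by (auto simp: subspace_def repD(2,3)[OF x] scale_right_distrib mult.commute)
  moreover have "\<rho> k e \<in> ?W" if "k \<in> K" "e \<in> ?W" for k e
    using that central[OF that(1)] repD(5)[OF x that(1), of e] repD(5)[OF that(1) x, of e]
    by (simp add: repD(3)[OF that(1)])
  ultimately have "?W = {0} \<or> ?W = UNIV" by (rule irrD)
  then show ?thesis
  proof
    assume "?W = UNIV"
    then show ?thesis using that[of 1] by auto
  next
    assume W: "?W = {0}"
    have "\<rho> x e + sc s e \<in> ?W" for e
      using sq[of e] repD(5)[OF x x, of e]
      by (simp add: repD(2,3)[OF x] scale_right_distrib power2_eq_square add.commute)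
    then have "\<rho> x e + sc s e = 0" for e unfolding W by simp
    then have "\<rho> x e = sc (of_int (-1) * s) e" for e
      by (simp add: eq_neg_iff_add_eq_0)
    then show ?thesis using that[of "-1"] by auto
  qed
qed

section \<open>Forms on multiplicity spaces and signatures\<close>

text \<open>This justifies the \<open>THE\<close> in \<open>eps\<close>: on a nonzero vector the
  scalars \<open>s\<close> and \<open>-s\<close> act differently because
  \<open>s \<noteq> 0\<close>.\<close>

lemma eps_eqI:
  fixes sc :: "complex \<Rightarrow> 'e::ab_group_add \<Rightarrow> 'e"
  assumes vs: "vector_space sc" and nz: "(UNIV :: 'e set) \<noteq> {0}" and s: "s \<noteq> 0"
    and \<epsilon>: "\<epsilon> \<in> {1, -1}" "\<And>e. \<rho> x e = sc (of_int \<epsilon> * s) e"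
  shows "eps sc \<rho> x s = \<epsilon>"
  unfolding eps_def
proof (rule the_equality)
  interpret vector_space sc by fact
  obtain e :: 'e where e: "e \<noteq> 0" using nz by auto
  fix \<delta> :: int assume "\<delta> \<in> {1, -1} \<and> (\<forall>e. \<rho> x e = sc (of_int \<delta> * s) e)"
  then have "sc (of_int \<delta> * s) e = sc (of_int \<epsilon> * s) e" using \<epsilon>(2) by metis
  then show "\<delta> = \<epsilon>" using e s by (simp add: scale_cancel_right)
qed (use \<epsilon> in simp)

text \<open>Unique existence cannot be dropped: otherwise \<open>THE\<close> in \<^const>\<open>mult_form\<close> picks an
  unspecified value on both sides.\<close>

lemma mult_form_scale:
  assumes ex1: "\<exists>!c. \<forall>e f. B (\<phi> e) (\<psi> f) = c * ip e f" and d: "d \<noteq> 0"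
    and B': "\<And>e f. B' (\<phi> e) (\<psi> f) = d * B (\<phi> e) (\<psi> f)"
  shows "mult_form ip B' \<phi> \<psi> = d * mult_form ip B \<phi> \<psi>"
proof -
  obtain c where c: "\<And>e f. B (\<phi> e) (\<psi> f) = c * ip e f" using ex1 by blast
  have "mult_form ip B \<phi> \<psi> = c"
    unfolding mult_form_def using c by (intro the1_equality ex1) simp
  moreover have "mult_form ip B' \<phi> \<psi> = d * c"
    unfolding mult_form_def
  proof (rule the_equality)
    fix c' assume c': "\<forall>e f. B' (\<phi> e) (\<psi> f) = c' * ip e f"
    have "\<forall>e f. B (\<phi> e) (\<psi> f) = (c' / d) * ip e f"
      using c' d by (simp add: B' field_simps)
    then have "c' / d = c" using ex1 c by blast
    then show "c' = d * c" using d by (simp add: field_simps)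
  qed (simp add: B' c)
  ultimately show ?thesis by simp
qed

lemma pos_dim_cong:
  assumes "\<And>v. v \<in> V \<Longrightarrow> Q v v = Q' v v"
  shows "pos_dim sc V Q = pos_dim sc V Q'"
  unfolding pos_dim_def by (rule arg_cong[where f = Sup]) (use assms in \<open>force simp: subset_iff\<close>)

lemma neg_dim_cong:
  assumes "\<And>v. v \<in> V \<Longrightarrow> Q v v = Q' v v"
  shows "neg_dim sc V Q = neg_dim sc V Q'"
  unfolding neg_dim_def by (rule arg_cong[where f = Sup]) (use assms in \<open>force simp: subset_iff\<close>)

lemma pos_dim_uminus: "pos_dim sc V (\<lambda>v w. - Q v w) = neg_dim sc V Q"
  and neg_dim_uminus: "neg_dim sc V (\<lambda>v w. - Q v w) = pos_dim sc V Q"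
  by (simp_all add: pos_dim_def neg_dim_def)

text \<open>By Hermitian symmetry the second slot is conjugate-linear, so scaling both arguments by
  \<zeta> multiplies the value by the square of \<open>norm \<zeta>\<close>.\<close>

lemma norm_eq_1_of_form_scaled:
  assumes "hermitian_form sc B"
    and "B v w \<noteq> 0" "B (sc \<zeta> v) (sc \<zeta> w) = B v w"
  shows "norm \<zeta> = 1"
proof -
  have "B (sc \<zeta> v) (sc \<zeta> w) = \<zeta> * cnj \<zeta> * B v w"
  proof -
    have scale: "B (sc c v') w' = c * B v' w'" for c v' w'
      using assms(1) unfolding hermitian_form_def Vector_Spaces.linear_iff by blast
    have sym: "B v' w' = cnj (B w' v')" for v' w'
      using assms(1) unfolding hermitian_form_def by blast
    show ?thesis
      using sym[of v "sc \<zeta> w"] sym[of v w] by (simp add: scale)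
  qed
  then have "\<zeta> * cnj \<zeta> = 1" using assms(2,3) by simp
  then have "complex_of_real ((norm \<zeta>)\<^sup>2) = 1" by (simp only: complex_norm_square)
  then have "(norm \<zeta>)\<^sup>2 = 1" using of_real_eq_1_iff by blast
  then show ?thesis by (simp add: abs_square_eq_1)
qed

theorem theorem11p2:
  fixes GC G K KC :: "'n::finite cmat set"
    and \<sigma>\<^sub>0 \<sigma>\<^sub>c \<theta> :: "'n cmat \<Rightarrow> 'n cmat"
    and x z :: "'n cmat"
    and scJ :: "complex \<Rightarrow> 'j::ab_group_add \<Rightarrow> 'j"
    and a \<pi> :: "'n cmat \<Rightarrow> 'j \<Rightarrow> 'j"
    and Bc B0 :: "'j \<Rightarrow> 'j \<Rightarrow> complex"
    and \<zeta> s :: complex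
  assumes "connected_reductive_group GC"
    and "real_form GC \<sigma>\<^sub>0"
    and "compact_real_form GC \<sigma>\<^sub>c"
    and "\<forall>g\<in>GC. \<sigma>\<^sub>0 (\<sigma>\<^sub>c g) = \<sigma>\<^sub>c (\<sigma>\<^sub>0 g)"
    and "\<theta> = \<sigma>\<^sub>0 \<circ> \<sigma>\<^sub>c"
    and "G = fixed_points GC \<sigma>\<^sub>0"
    and "K = fixed_points G \<theta>"
    and "KC = fixed_points GC \<theta>"
    and "equal_rank G K"
    and "strong_involution GC G K \<theta> x"
    and "z = x ** x"
    and "irreducible_gK_module GC KC scJ a \<pi>"
    and "invariant_hermitian_form GC K \<sigma>\<^sub>c scJ a \<pi> Bc"
    and "\<zeta> \<noteq> 0"
    and "\<forall>v. \<pi> z v = scJ \<zeta> v"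
    and "s\<^sup>2 = \<zeta>"
    and "\<forall>v w. B0 v w = inverse s * Bc (\<pi> x v) w"
  shows "invariant_hermitian_form GC K \<sigma>\<^sub>0 scJ a \<pi> B0 \<and>
    (\<forall>(scE :: complex \<Rightarrow> 'e::ab_group_add \<Rightarrow> 'e) \<rho> ip.
       irreducible_rep K scE \<rho> \<and> unitary_structure K scE \<rho> ip \<and>
       (\<forall>e. \<rho> z e = scE \<zeta> e) \<longrightarrow>
         eps scE \<rho> x s \<in> {1, -1} \<and>
         (\<forall>e. \<rho> x e = scE (of_int (eps scE \<rho> x s) * s) e) \<and>
         (\<forall>\<phi>\<in>Hom_K K scE \<rho> scJ \<pi>. \<forall>\<psi>\<in>Hom_K K scE \<rho> scJ \<pi>.
            mult_form ip B0 \<phi> \<psi> = of_int (eps scE \<rho> x s) * mult_form ip Bc \<phi> \<psi>) \<and>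
         signature K scE \<rho> ip scJ \<pi> B0 =
           (if eps scE \<rho> x s = 1 then signature K scE \<rho> ip scJ \<pi> Bc
            else prod.swap (signature K scE \<rho> ip scJ \<pi> Bc)))"
proof -

  \<comment> \<open>The groups \<open>G\<close>, \<open>K\<close>, \<open>KC\<close> and the central
    element \<open>x\<close>\<close>
  have GC: "matrix_group GC"
    using assms(1) by (simp add: connected_reductive_group_def algebraic_group_def)
  have \<sigma>: "\<sigma>\<^sub>0 g \<in> GC" "\<sigma>\<^sub>0 (\<sigma>\<^sub>0 g) = g" "\<sigma>\<^sub>c g \<in> GC" "\<sigma>\<^sub>c (\<sigma>\<^sub>c g) = g"
    if "g \<in> GC" for g
    using assms(2,3) that by (simp_all add: real_form_def compact_real_form_def)
  have hom: "\<sigma>\<^sub>0 (g ** h) = \<sigma>\<^sub>0 g ** \<sigma>\<^sub>0 h" "\<sigma>\<^sub>c (g ** h) = \<sigma>\<^sub>c g ** \<sigma>\<^sub>c h"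
    if "g \<in> GC" "h \<in> GC" for g h
    using assms(2,3) that by (simp_all add: real_form_def compact_real_form_def)
  have \<theta>: "\<theta> g \<in> GC" if "g \<in> GC" for g
    using that \<sigma> by (simp add: assms(5))
  have \<theta>_hom: "\<theta> (g ** h) = \<theta> g ** \<theta> h" if "g \<in> GC" "h \<in> GC" for g h
    using that \<sigma> hom by (simp add: assms(5))
  have G: "matrix_group G" "G \<subseteq> GC"
    unfolding assms(6) using matrix_group_fixed_points[OF GC] \<sigma> hom
    by (auto simp: fixed_points_def)
  \<comment> \<open>Commutation of the two real forms is used here: for \<open>g\<close> fixed by
    \<open>\<sigma>\<^sub>0\<close> it gives \<open>\<theta> g = \<sigma>\<^sub>c g\<close>, which
    is fixed by \<open>\<sigma>\<^sub>0\<close> as well.\<close>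
  have \<theta>G: "\<theta> g \<in> G" if "g \<in> G" for g
    using that \<sigma> assms(4) by (simp add: assms(5,6) fixed_points_def)
  have K: "matrix_group K"
    unfolding assms(7) using G \<theta>_hom \<theta>G by (intro matrix_group_fixed_points) blast+
  have KC: "matrix_group KC"
    unfolding assms(8) using \<theta> \<theta>_hom by (intro matrix_group_fixed_points GC) auto
  have KKC: "K \<subseteq> KC" using G(2) by (auto simp: assms(7,8) fixed_points_def)

  have xG: "x \<in> G" and Ad_x: "\<And>g. g \<in> GC \<Longrightarrow> x ** g ** matrix_inv x = \<theta> g"
    and K_eq: "K = {g \<in> G. x ** g ** matrix_inv x = g}"
    using assms(10) by (auto simp: strong_involution_def)
  have xGC: "x \<in> GC" and inv_x: "invertible x"
    using xG G matrix_groupD(2)[OF G(1)] by auto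
  have xK: "x \<in> K"
    using xG by (simp add: K_eq invertible_right_inverse[OF inv_x] flip: matrix_mul_assoc)
  have central: "x ** k = k ** x" if "k \<in> K" for k
  proof -
    have "x ** k = (x ** k ** matrix_inv x) ** x"
      by (simp add: invertible_left_inverse[OF inv_x] flip: matrix_mul_assoc)
    then show ?thesis using that by (simp add: K_eq)
  qed
  have xKC: "x \<in> KC" and zK: "z \<in> K" and zKC: "z \<in> KC"
    using xK KKC matrix_groupD(4)[OF K xK xK] by (auto simp: assms(11))

  \<comment> \<open>The module \<open>J\<close> and the form \<open>Bc\<close>\<close>
  have gK: "gK_module GC KC scJ a \<pi>"
    using assms(12) by (simp add: irreducible_gK_module_def)
  have rep: "group_rep KC scJ \<pi>"
    using gK by (simp add: gK_module_def algebraic_rep_def)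
  note repD = group_repD[OF rep]
  have equivariant: "\<pi> x (a X v) = a (x ** X ** matrix_inv x) (\<pi> x v)" if "X \<in> Lie GC" for X v
    using gK xKC that by (simp add: gK_module_def)
  interpret J: vector_space scJ by (rule repD(1))

  have herm: "hermitian_form scJ Bc"
    and Bc_K: "\<And>k v w. k \<in> K \<Longrightarrow> Bc (\<pi> k v) w = Bc v (\<pi> (matrix_inv k) w)"
    and Bc_Lie: "\<And>X v w. X \<in> Lie GC \<Longrightarrow> Bc (a X v) w = - Bc v (a (differential \<sigma>\<^sub>c X) w)"
    using assms(13) by (simp_all add: invariant_hermitian_form_def)
  have Bc_lin: "Bc (u + v) w = Bc u w + Bc v w" "Bc (scJ c v) w = c * Bc v w" for c u v w
    using hermitian_form_sesquilinear(1)[OF herm, of w] unfolding Vector_Spaces.linear_iff by blast+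
  have Bc_sym: "Bc w v = cnj (Bc v w)" for v w
    using herm unfolding hermitian_form_def by blast
  have Bc_unitary: "Bc (\<pi> k v) (\<pi> k w) = Bc v w" if "k \<in> K" for k v w
    using Bc_K[OF that] group_rep_inv(2)[OF rep KC] that KKC by auto
  have s: "s \<noteq> 0" using assms(14,16) by auto
  \<comment> \<open>From \<open>x = x^{-1} z\<close> and the scalar action of
    \<open>z\<close>.\<close>
  have x_inv: "\<pi> (matrix_inv x) v = scJ (inverse \<zeta>) (\<pi> x v)" for v
  proof -
    have "\<pi> x v = \<pi> (matrix_inv x) (\<pi> z v)"
      using repD(5)[OF xKC xKC, of v] group_rep_inv(2)[OF rep KC xKC] by (simp add: assms(11))
    also have "\<dots> = scJ \<zeta> (\<pi> (matrix_inv x) v)"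
      using assms(15) repD(3)[OF matrix_groupD(3)[OF KC xKC]] by simp
    finally show ?thesis using assms(14) by simp
  qed

  \<comment> \<open>Hermitian symmetry and invariance of \<open>B0\<close>\<close>
  have B0: "B0 v w = inverse s * Bc (\<pi> x v) w" for v w using assms(17) by blast
  \<comment> \<open>Moving \<open>x\<close> to the second slot produces the inverse of
    \<open>x\<close>, which acts as \<open>x\<close> divided by \<zeta>; Hermitian symmetry then
    brings it back to the first slot.\<close>
  have flip: "Bc (\<pi> x w) v = cnj (inverse \<zeta> * Bc (\<pi> x v) w)" for v w
    using Bc_K[OF xK, of w v] Bc_sym[of w "\<pi> (matrix_inv x) v"] by (simp add: x_inv Bc_lin)
  \<comment> \<open>If \<open>Bc (\<pi> x v) w\<close> vanishes, so do both sides, by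
    \<open>flip\<close>. Otherwise this nonzero value, preserved by \<open>z\<close>, forces \<zeta>
    and \<open>s\<close> to have absolute value 1.\<close>
  have "B0 w v = cnj (B0 v w)" for v w
  proof (cases "Bc (\<pi> x v) w = 0")
    case True
    with flip[of w v] True show ?thesis by (simp add: B0)
  next
    case False
    have "norm \<zeta> = 1"
      using norm_eq_1_of_form_scaled[OF herm False, of \<zeta>]
        Bc_unitary[OF zK, of "\<pi> x v" w] assms(15) by simp
    then have "(norm s)\<^sup>2 = 1" using assms(16) by (metis norm_power)
    then have "norm s = 1" by (simp add: abs_square_eq_1)
    then have ss: "s * cnj s = 1" using complex_norm_square[of s] by simp
    note flip[of w v]
    \<comment> \<open>With these values \<open>flip\<close> contributes the factor
      \<open>s\<^sup>2\<close>, and \<open>cnj s * s\<^sup>2 = s\<close> is the conjugate of the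
      normalizing factor \<open>inverse s\<close>.\<close>
    moreover have "inverse \<zeta> = (cnj s)\<^sup>2" "inverse s = cnj s"
      using ss s assms(16) by (auto simp: field_simps power2_eq_square)
    ultimately show ?thesis
      using ss by (simp add: B0 power2_eq_square) (metis mult.assoc mult.commute mult.right_neutral)
  qed
  moreover have "functional scJ (\<lambda>v. B0 v w)" for w
    using hermitian_form_sesquilinear(1)[OF herm, of w] unfolding Vector_Spaces.linear_iff
    by (simp add: B0 repD(2,3)[OF xKC] Bc_lin algebra_simps)
  ultimately have B0_herm: "hermitian_form scJ B0"
    unfolding hermitian_form_def by blast
  have B0_K: "B0 (\<pi> k v) w = B0 v (\<pi> (matrix_inv k) w)" if "k \<in> K" for k v w
  proof -
    have "\<pi> x (\<pi> k v) = \<pi> k (\<pi> x v)"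
      using that KKC repD(5)[of x k v] repD(5)[of k x v] xKC central[OF that] by auto
    then show ?thesis by (simp add: B0 Bc_K[OF that])
  qed
  have B0_Lie: "B0 (a X v) w = - B0 v (a (differential \<sigma>\<^sub>0 X) w)" if X: "X \<in> Lie GC" for X v w
  proof -
    have "\<sigma>\<^sub>c (x ** g ** matrix_inv x) = \<sigma>\<^sub>0 g" if "g \<in> GC" for g
      using Ad_x[OF that] assms(4) \<sigma> that by (simp add: assms(5))
    then have "differential \<sigma>\<^sub>c (x ** X ** matrix_inv x) = differential \<sigma>\<^sub>0 X"
      by (rule differential_conj[OF GC xGC X])
    then show ?thesis
      by (simp add: B0 equivariant[OF X] Bc_Lie[OF conj_in_Lie[OF GC xGC X]])
  qed
  have inv0: "invariant_hermitian_form GC K \<sigma>\<^sub>0 scJ a \<pi> B0"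
    using B0_herm B0_K B0_Lie by (simp add: invariant_hermitian_form_def)

  \<comment> \<open>Comparison on the multiplicity spaces\<close>
  show ?thesis
  proof (intro conjI[OF inv0] allI impI, elim conjE)
    fix scE :: "complex \<Rightarrow> 'e \<Rightarrow> 'e" and \<rho> :: "'n cmat \<Rightarrow> 'e \<Rightarrow> 'e" and ip :: "'e \<Rightarrow> 'e \<Rightarrow> complex"
    assume irr: "irreducible_rep K scE \<rho>" and ip: "unitary_structure K scE \<rho> ip"
      and z: "\<forall>e. \<rho> z e = scE \<zeta> e"
    have repE: "group_rep K scE \<rho>" and nz: "(UNIV :: 'e set) \<noteq> {0}"
      using irr by (simp_all add: irreducible_rep_def)
    let ?\<epsilon> = "eps scE \<rho> x s"
    obtain \<epsilon> :: int where \<epsilon>: "\<epsilon> \<in> {1, -1}" "\<And>e. \<rho> x e = scE (of_int \<epsilon> * s) e"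
      using central_square_root_sign[OF irr xK central, of s] z by (auto simp: assms(11,16))
    have eps: "?\<epsilon> = \<epsilon>" by (rule eps_eqI[where \<rho> = \<rho>, OF group_repD(1)[OF repE] nz s \<epsilon>])
    let ?H = "Hom_K K scE \<rho> scJ \<pi>"
    have mult: "mult_form ip B0 \<phi> \<psi> = of_int \<epsilon> * mult_form ip Bc \<phi> \<psi>"
      if "\<phi> \<in> ?H" "\<psi> \<in> ?H" for \<phi> \<psi>
    proof (rule mult_form_scale)
      have lin: "\<eta> (e + f) = \<eta> e + \<eta> f" "\<eta> (scE c e) = scJ c (\<eta> e)"
        and equiv: "k \<in> K \<Longrightarrow> \<eta> (\<rho> k e) = \<pi> k (\<eta> e)" if "\<eta> \<in> ?H" for \<eta> c e f k
        using that by (auto simp: Hom_K_def Vector_Spaces.linear_iff)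
      \<comment> \<open>The pullback of \<open>Bc\<close> along \<phi> and \<psi> is a
        \<open>K\<close>-invariant sesquilinear form on \<open>E\<close>, so Schur's lemma applies
        to it.\<close>
      show "\<exists>!c. \<forall>e f. Bc (\<phi> e) (\<psi> f) = c * ip e f"
      proof (rule invariant_form_multiple[OF K irr ip])
        show "functional scE (\<lambda>e. Bc (\<phi> e) (\<psi> f))" for f
          using hermitian_form_sesquilinear(1)[OF herm, of "\<psi> f"] group_repD(1)[OF repE]
          unfolding Vector_Spaces.linear_iff by (simp add: lin[OF that(1)] Bc_lin)
        show "functional scE (\<lambda>f. cnj (Bc (\<phi> e) (\<psi> f)))" for e
          using hermitian_form_sesquilinear(2)[OF herm, of "\<phi> e"] group_repD(1)[OF repE]
          unfolding Vector_Spaces.linear_iff by (simp add: lin[OF that(2)])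
        show "Bc (\<phi> (\<rho> k e)) (\<psi> (\<rho> k f)) = Bc (\<phi> e) (\<psi> f)" if "k \<in> K" for k e f
          using that by (simp add: equiv \<open>\<phi> \<in> ?H\<close> \<open>\<psi> \<in> ?H\<close> Bc_unitary)
      qed
      show "(of_int \<epsilon> :: complex) \<noteq> 0" using \<epsilon>(1) by auto
      fix e f
      \<comment> \<open>Since \<phi> intertwines the actions, \<open>x\<close> acts on its image by
        the scalar it has on \<open>E\<close>; the factor \<open>s\<close> then cancels the
        \<open>inverse s\<close> in \<open>B0\<close>.\<close>
      have "\<pi> x (\<phi> e) = scJ (of_int \<epsilon> * s) (\<phi> e)"
        using equiv[OF that(1) xK, of e] by (simp add: \<epsilon>(2) lin[OF that(1)])
      then show "B0 (\<phi> e) (\<psi> f) = of_int \<epsilon> * Bc (\<phi> e) (\<psi> f)"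
        using s by (simp add: B0 Bc_lin)
    qed
    have sig: "signature K scE \<rho> ip scJ \<pi> B0 =
      (if \<epsilon> = 1 then signature K scE \<rho> ip scJ \<pi> Bc else prod.swap (signature K scE \<rho> ip scJ \<pi> Bc))"
    proof (cases "\<epsilon> = 1")
      case True
      \<comment> \<open>Definiteness involves only diagonal values, so the case
        \<open>\<phi> = \<psi>\<close> of \<open>mult\<close> suffices.\<close>
      then have "mult_form ip B0 \<phi> \<phi> = mult_form ip Bc \<phi> \<phi>" if "\<phi> \<in> ?H" for \<phi>
        using mult[OF that that] by simp
      then show ?thesis
        using True unfolding signature_def by (simp cong: pos_dim_cong neg_dim_cong)
    next
      case False
      \<comment> \<open>Negating a form exchanges its positive and negative definite subspaces,
        which produces the swap.\<close>
      then have "mult_form ip B0 \<phi> \<phi> = - mult_form ip Bc \<phi> \<phi>" if "\<phi> \<in> ?H" for \<phi>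
        using mult[OF that that] \<epsilon>(1) by simp
      then show ?thesis
        using False pos_dim_cong[of ?H "mult_form ip B0" "\<lambda>\<phi> \<psi>. - mult_form ip Bc \<phi> \<psi>"]
          neg_dim_cong[of ?H "mult_form ip B0" "\<lambda>\<phi> \<psi>. - mult_form ip Bc \<phi> \<psi>"]
        unfolding signature_def by (simp add: pos_dim_uminus neg_dim_uminus)
    qed
    show "?\<epsilon> \<in> {1, -1} \<and> (\<forall>e. \<rho> x e = scE (of_int ?\<epsilon> * s) e) \<and>
      (\<forall>\<phi>\<in>?H. \<forall>\<psi>\<in>?H. mult_form ip B0 \<phi> \<psi> = of_int ?\<epsilon> * mult_form ip Bc \<phi> \<psi>) \<and>
      signature K scE \<rho> ip scJ \<pi> B0 =
       (if ?\<epsilon> = 1 then signature K scE \<rho> ip scJ \<pi> Bc else prod.swap (signature K scE \<rho> ip scJ \<pi> Bc))"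
      unfolding eps using \<epsilon> mult sig by blast
  qed
qed

end
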